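(* Every axiomatic extension $\mathcal L$ of the Glivenko logic of classical logic with respect to $\mathcal{FL}_w$ is passively structurally complete.
   Context: $\mathcal{FL}_w$ is the Full Lambek calculus with weakening, whose equivalent algebraic semantics is the variety of $\mathsf{FL}_w$-algebras: $(A,\vee,\wedge,\cdot,\backslash,/,1,0)$ with $(A,\vee,\wedge)$ a lattice, $(A,\cdot,1)$ a monoid, $x\cdot y\le z$ iff $y\le x\backslash z$ iff $x\le z/y$, and $0\le x\le 1$. Write $\neg x = x\backslash 0$ and $\sim x = 0/x$. Two logics $\mathcal L_1,\mathcal L_2$ are Glivenko equivalent if for every formula $\varphi$, $\vdash_{\mathcal L_1}\neg\varphi$ iff $\vdash_{\mathcal L_2}\neg\varphi$. The Glivenko logic of classical logic with respect to $\mathcal{FL}_w$ is the smallest axiomatic extension of $\mathcal{FL}_w$ that is Glivenko equivalent to classical logic; it is axiomatized relative to $\mathcal{FL}_w$ by $\{\neg\sim\varphi : \varphi \text{ a classical tautology}\}$. A rule $\Sigma\Rightarrow\gamma$ (finite $\Sigma$) is admissible if every substitution making all formulas of $\Sigma$ theorems makes $\gamma$ a theorem, passive if no substitution makes all of $\Sigma$ theorems, derivable if $\Sigma\vdash_{\mathcal L}\gamma$. $\mathcal L$ is passively structurally complete if every passive admissible rule is derivable. *)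

theory Defs
  imports Main
begin

datatype fm =
    Var nat
  | Zero
  | One
  | Conj fm fm
  | Disj fm fm
  | Fuse fm fm
  | Under fm fm  \<comment> \<open>\<open>Under a b\<close> is \<open>a \ b\<close>\<close>
  | Over fm fm   \<comment> \<open>\<open>Over b a\<close> is \<open>b / a\<close>\<close>

definition lneg :: "fm \<Rightarrow> fm" where
  "lneg a = Under a Zero"

definition rneg :: "fm \<Rightarrow> fm" where
  "rneg a = Over Zero a"

primrec subst :: "(nat \<Rightarrow> fm) \<Rightarrow> fm \<Rightarrow> fm" where
  "subst s (Var n) = s n"
| "subst s Zero = Zero"
| "subst s One = One"
| "subst s (Conj a b) = Conj (subst s a) (subst s b)"
| "subst s (Disj a b) = Disj (subst s a) (subst s b)"
| "subst s (Fuse a b) = Fuse (subst s a) (subst s b)"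
| "subst s (Under a b) = Under (subst s a) (subst s b)"
| "subst s (Over a b) = Over (subst s a) (subst s b)"

text \<open>
  A sequent has a list of formulas on the left (there is neither exchange nor
  contraction) and at most one formula on the right (\<open>None\<close> is the empty right-hand side).
  \<open>flw_seq H X p\<close> says that \<open>X \<Rightarrow> p\<close> is derivable when the sequents
  \<open>\<Rightarrow> a\<close> with \<open>a\<close> in \<open>H\<close> are added as initial sequents.
\<close>

inductive flw_seq :: "fm set \<Rightarrow> fm list \<Rightarrow> fm option \<Rightarrow> bool" for H :: "fm set" where
  Hyp: "a \<in> H \<Longrightarrow> flw_seq H [] (Some a)"
| Init: "flw_seq H [a] (Some a)"
| Cut: "flw_seq H X (Some a) \<Longrightarrow> flw_seq H (Y @ [a] @ Z) p \<Longrightarrow> flw_seq H (Y @ X @ Z) p"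
| WeakL: "flw_seq H (X @ Y) p \<Longrightarrow> flw_seq H (X @ [a] @ Y) p"
| WeakR: "flw_seq H X None \<Longrightarrow> flw_seq H X (Some a)"
| OneL: "flw_seq H (X @ Y) p \<Longrightarrow> flw_seq H (X @ [One] @ Y) p"
| OneR: "flw_seq H [] (Some One)"
| ZeroL: "flw_seq H [Zero] None"
| ZeroR: "flw_seq H X None \<Longrightarrow> flw_seq H X (Some Zero)"
| ConjL1: "flw_seq H (X @ [a] @ Y) p \<Longrightarrow> flw_seq H (X @ [Conj a b] @ Y) p"
| ConjL2: "flw_seq H (X @ [b] @ Y) p \<Longrightarrow> flw_seq H (X @ [Conj a b] @ Y) p"
| ConjR: "flw_seq H X (Some a) \<Longrightarrow> flw_seq H X (Some b) \<Longrightarrow> flw_seq H X (Some (Conj a b))"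
| DisjL: "flw_seq H (X @ [a] @ Y) p \<Longrightarrow> flw_seq H (X @ [b] @ Y) p \<Longrightarrow>
    flw_seq H (X @ [Disj a b] @ Y) p"
| DisjR1: "flw_seq H X (Some a) \<Longrightarrow> flw_seq H X (Some (Disj a b))"
| DisjR2: "flw_seq H X (Some b) \<Longrightarrow> flw_seq H X (Some (Disj a b))"
| FuseL: "flw_seq H (X @ [a, b] @ Y) p \<Longrightarrow> flw_seq H (X @ [Fuse a b] @ Y) p"
| FuseR: "flw_seq H X (Some a) \<Longrightarrow> flw_seq H Y (Some b) \<Longrightarrow> flw_seq H (X @ Y) (Some (Fuse a b))"
| UnderL: "flw_seq H X (Some a) \<Longrightarrow> flw_seq H (Y @ [b] @ Z) p \<Longrightarrow>
    flw_seq H (Y @ X @ [Under a b] @ Z) p"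
| UnderR: "flw_seq H ([a] @ X) (Some b) \<Longrightarrow> flw_seq H X (Some (Under a b))"
| OverL: "flw_seq H X (Some a) \<Longrightarrow> flw_seq H (Y @ [b] @ Z) p \<Longrightarrow>
    flw_seq H (Y @ [Over b a] @ X @ Z) p"
| OverR: "flw_seq H (X @ [a]) (Some b) \<Longrightarrow> flw_seq H X (Some (Over b a))"

type_synonym logic = "fm set \<Rightarrow> fm \<Rightarrow> bool"

definition FLw :: logic where
  "FLw H a \<longleftrightarrow> flw_seq H [] (Some a)"

abbreviation thm_of :: "logic \<Rightarrow> fm \<Rightarrow> bool" where
  "thm_of L a \<equiv> L {} a"

definition axiomatic_extension :: "logic \<Rightarrow> logic \<Rightarrow> bool" where
  "axiomatic_extension L L' \<longleftrightarrow>
    (\<exists>A. \<forall>H a. L' H a \<longleftrightarrow> L (H \<union> {subst s b | s b. b \<in> A}) a)"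

text \<open>
  Classical logic in the same language: fusion is read as conjunction, both
  residuals as implication.
\<close>

primrec truth :: "(nat \<Rightarrow> bool) \<Rightarrow> fm \<Rightarrow> bool" where
  "truth v (Var n) = v n"
| "truth v Zero = False"
| "truth v One = True"
| "truth v (Conj a b) = (truth v a \<and> truth v b)"
| "truth v (Disj a b) = (truth v a \<or> truth v b)"
| "truth v (Fuse a b) = (truth v a \<and> truth v b)"
| "truth v (Under a b) = (truth v a \<longrightarrow> truth v b)"
| "truth v (Over b a) = (truth v a \<longrightarrow> truth v b)"

definition CL :: logic where
  "CL H a \<longleftrightarrow> (\<forall>v. (\<forall>b\<in>H. truth v b) \<longrightarrow> truth v a)"

definition glivenko_equivalent :: "logic \<Rightarrow> logic \<Rightarrow> bool" where
  "glivenko_equivalent L1 L2 \<longleftrightarrow> (\<forall>a. thm_of L1 (lneg a) \<longleftrightarrow> thm_of L2 (lneg a))"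

text \<open>
  The Glivenko logic of \<open>K\<close> with respect to \<open>L\<close>. Logics are ordered by inclusion
  of consequence relations, which is the pointwise order on predicates; the least element
  exists in the case used here by \<open>is_least_glivenko\<close> below.
\<close>

definition glivenko_logic :: "logic \<Rightarrow> logic \<Rightarrow> logic" where
  "glivenko_logic K L = (LEAST G. axiomatic_extension L G \<and> glivenko_equivalent G K)"

definition admissible_rule :: "logic \<Rightarrow> fm set \<Rightarrow> fm \<Rightarrow> bool" where
  "admissible_rule L S c \<longleftrightarrow> (\<forall>s. (\<forall>a\<in>S. thm_of L (subst s a)) \<longrightarrow> thm_of L (subst s c))"

definition passive_rule :: "logic \<Rightarrow> fm set \<Rightarrow> bool" where
  "passive_rule L S \<longleftrightarrow> \<not> (\<exists>s. \<forall>a\<in>S. thm_of L (subst s a))"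

definition derivable_rule :: "logic \<Rightarrow> fm set \<Rightarrow> fm \<Rightarrow> bool" where
  "derivable_rule L S c \<longleftrightarrow> L S c"

definition passively_structurally_complete :: "logic \<Rightarrow> bool" where
  "passively_structurally_complete L \<longleftrightarrow>
    (\<forall>S c. finite S \<longrightarrow> passive_rule L S \<longrightarrow> admissible_rule L S c \<longrightarrow> derivable_rule L S c)"

lemma flw_trans:
  assumes "flw_seq H X p" and hyps: "\<And>a. a \<in> H \<Longrightarrow> FLw K a"
  shows "flw_seq K X p"
  using assms(1)
proof (induction rule: flw_seq.induct)
  case (Hyp a)
  then show ?case using hyps by (simp add: FLw_def)
next
  case Init show ?case by (rule flw_seq.Init)
next
  case Cut from Cut.IH show ?case by (rule flw_seq.Cut)
next
  case WeakL from WeakL.IH show ?case by (rule flw_seq.WeakL)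
next
  case WeakR from WeakR.IH show ?case by (rule flw_seq.WeakR)
next
  case OneL from OneL.IH show ?case by (rule flw_seq.OneL)
next
  case OneR show ?case by (rule flw_seq.OneR)
next
  case ZeroL show ?case by (rule flw_seq.ZeroL)
next
  case ZeroR from ZeroR.IH show ?case by (rule flw_seq.ZeroR)
next
  case ConjL1 from ConjL1.IH show ?case by (rule flw_seq.ConjL1)
next
  case ConjL2 from ConjL2.IH show ?case by (rule flw_seq.ConjL2)
next
  case ConjR from ConjR.IH show ?case by (rule flw_seq.ConjR)
next
  case DisjL from DisjL.IH show ?case by (rule flw_seq.DisjL)
next
  case DisjR1 from DisjR1.IH show ?case by (rule flw_seq.DisjR1)
next
  case DisjR2 from DisjR2.IH show ?case by (rule flw_seq.DisjR2)
next
  case FuseL from FuseL.IH show ?case by (rule flw_seq.FuseL)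
next
  case FuseR from FuseR.IH show ?case by (rule flw_seq.FuseR)
next
  case UnderL from UnderL.IH show ?case by (rule flw_seq.UnderL)
next
  case UnderR from UnderR.IH show ?case by (rule flw_seq.UnderR)
next
  case OverL from OverL.IH show ?case by (rule flw_seq.OverL)
next
  case OverR from OverR.IH show ?case by (rule flw_seq.OverR)
qed

lemma flw_sound:
  assumes "flw_seq H X p" and hyps: "\<And>a. a \<in> H \<Longrightarrow> truth v a"
  shows "list_all (truth v) X \<longrightarrow> (\<exists>c. p = Some c \<and> truth v c)"
  using assms(1) by (induction rule: flw_seq.induct) (auto simp: hyps)

lemma truth_subst: "truth v (subst s a) = truth (\<lambda>n. truth v (s n)) a"
  by (induction a) auto

lemma CL_subst: "thm_of CL a \<Longrightarrow> thm_of CL (subst s a)"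
  by (simp add: CL_def truth_subst)

lemma subst_Var: "subst Var a = a"
  by (induction a) auto

lemma FLw_lneg_rneg_lneg: "FLw {lneg (rneg (lneg a))} (lneg a)"
proof -
  let ?H = "{lneg (rneg (lneg a))}"
  have zero: "flw_seq ?H [Zero] (Some Zero)"
    by (rule flw_seq.Init)
  have "flw_seq ?H ([] @ [a] @ [Under a Zero] @ []) (Some Zero)"
    by (rule flw_seq.UnderL) (use zero in \<open>simp_all add: flw_seq.Init\<close>)
  then have 1: "flw_seq ?H [a] (Some (rneg (lneg a)))"
    unfolding rneg_def lneg_def by (intro flw_seq.OverR) simp
  have "flw_seq ?H ([] @ [a] @ [Under (rneg (lneg a)) Zero] @ []) (Some Zero)"
    by (rule flw_seq.UnderL) (use 1 zero in simp_all)
  then have 2: "flw_seq ?H ([a] @ [lneg (rneg (lneg a))] @ []) (Some Zero)"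
    by (simp add: lneg_def)
  have "flw_seq ?H ([a] @ [] @ []) (Some Zero)"
    by (rule flw_seq.Cut[OF flw_seq.Hyp 2]) simp
  then show ?thesis
    unfolding FLw_def lneg_def[of a] by (intro flw_seq.UnderR) simp
qed

lemma is_least_glivenko:
  fixes G :: logic
  defines "G \<equiv> \<lambda>H. FLw (H \<union> {lneg (rneg a) | a. thm_of CL a})"
  shows "axiomatic_extension FLw G" and "glivenko_equivalent G CL"
    and "axiomatic_extension FLw K \<Longrightarrow> glivenko_equivalent K CL \<Longrightarrow> G \<le> K"
proof -
  let ?A = "{lneg (rneg a) | a. thm_of CL a}"
  have closed: "{subst s b | s b. b \<in> ?A} = ?A"
  proof
    show "{subst s b | s b. b \<in> ?A} \<subseteq> ?A"
    proof
      fix x assume "x \<in> {subst s b | s b. b \<in> ?A}"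
      then obtain s a where "x = subst s (lneg (rneg a))" "thm_of CL a" by blast
      then have "x = lneg (rneg (subst s a))" "thm_of CL (subst s a)"
        by (simp_all add: lneg_def rneg_def CL_subst)
      then show "x \<in> ?A" by blast
    qed
    show "?A \<subseteq> {subst s b | s b. b \<in> ?A}"
    proof
      fix x assume "x \<in> ?A"
      then show "x \<in> {subst s b | s b. b \<in> ?A}"
        using subst_Var[of x] by (intro CollectI exI[of _ Var] exI[of _ x]) auto
    qed
  qed
  show "axiomatic_extension FLw G"
    unfolding axiomatic_extension_def by (intro exI[of _ ?A]) (simp only: closed G_def simp_thms)
  show "glivenko_equivalent G CL"
    unfolding glivenko_equivalent_def
  proof (intro allI iffI)
    fix a assume "thm_of G (lneg a)"
    then have "flw_seq ?A [] (Some (lneg a))" by (simp add: G_def FLw_def)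
    moreover have "truth v b" if "b \<in> ?A" for v b
      using that by (auto simp: CL_def lneg_def rneg_def)
    ultimately have "truth v (lneg a)" for v
      using flw_sound[of ?A "[]" "Some (lneg a)" v] by simp
    then show "thm_of CL (lneg a)" by (simp add: CL_def)
  next
    fix a assume "thm_of CL (lneg a)"
    then have "lneg (rneg (lneg a)) \<in> ?A" by blast
    then have *: "\<And>b. b \<in> {lneg (rneg (lneg a))} \<Longrightarrow> FLw ?A b"
      by (auto simp: FLw_def intro!: flw_seq.Hyp)
    have "flw_seq {lneg (rneg (lneg a))} [] (Some (lneg a))"
      using FLw_lneg_rneg_lneg[of a] by (simp add: FLw_def)
    from flw_trans[OF this *] show "thm_of G (lneg a)"
      by (simp add: G_def FLw_def)
  qed
  assume K: "axiomatic_extension FLw K" "glivenko_equivalent K CL"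
  then obtain B where B: "\<And>H a. K H a \<longleftrightarrow> FLw (H \<union> {subst s b | s b. b \<in> B}) a"
    unfolding axiomatic_extension_def by blast
  let ?B = "{subst s b | s b. b \<in> B}"
  have "FLw ?B x" if x: "x \<in> ?A" for x
  proof -
    from x obtain a where a: "x = lneg (rneg a)" "thm_of CL a" by blast
    then have "thm_of CL x" by (auto simp: CL_def lneg_def rneg_def)
    then have "K {} x" using K(2) a(1) by (simp add: glivenko_equivalent_def)
    then show ?thesis using B[of "{}" x] by simp
  qed
  then have A: "flw_seq ?B [] (Some x)" if "x \<in> ?A" for x
    using that unfolding FLw_def by blast
  have *: "FLw (H \<union> ?B) x" if x: "x \<in> H \<union> ?A" for H x
  proof (cases "x \<in> H")
    case True
    then show ?thesis unfolding FLw_def by (intro flw_seq.Hyp UnI1)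
  next
    case False
    then have "x \<in> ?A" using x by blast
    then show ?thesis unfolding FLw_def
      by (rule flw_trans[OF A]) (unfold FLw_def, intro flw_seq.Hyp UnI2)
  qed
  show "G \<le> K"
  proof (intro le_funI le_boolI)
    fix H a assume "G H a"
    then have "flw_seq (H \<union> ?A) [] (Some a)" by (simp add: G_def FLw_def)
    from flw_trans[OF this *] show "K H a"
      unfolding B by (simp add: FLw_def)
  qed
qed

theorem glivenko_logic_CL_FLw:
  "glivenko_logic CL FLw H a \<longleftrightarrow> FLw (H \<union> {lneg (rneg b) | b. thm_of CL b}) a"
proof -
  have "glivenko_logic CL FLw = (\<lambda>H. FLw (H \<union> {lneg (rneg b) | b. thm_of CL b}))"
    unfolding glivenko_logic_def
    by (rule Least_equality) (use is_least_glivenko in blast)+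
  then show ?thesis by simp
qed

end

theory Submission
  imports Defs
begin

text \<open>
  Under a substitution of the constants 0 and 1 for the variables, every formula is provably
  1 or provably 0 in \<open>FLw\<close>, according to its classical truth value. So a classically satisfiable
  set of premises is unified by such a substitution, and the premises of a passive rule are
  jointly unsatisfiable. The negation of their conjunction is then a classical theorem, hence
  by Glivenko equivalence a theorem of every extension of the Glivenko logic, and the premises
  derive 0 and with it everything.
\<close>

lemma flw_mono: "flw_seq H X p \<Longrightarrow> H \<subseteq> K \<Longrightarrow> flw_seq K X p"
  by (rule flw_trans) (auto simp: FLw_def intro: flw_seq.Hyp)

lemma flw_weakL_single: "flw_seq H [] p \<Longrightarrow> flw_seq H [a] p"
  using flw_seq.WeakL[of H "[]" "[]" p a] by simp

text \<open>Falsity is expressed by an empty right-hand side, so that the left rules apply directly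
  to the induction hypotheses. Weakening handles fusions and residuals whose value is decided by one
  component alone.\<close>

lemma flw_two_valued_subst:
  defines "s v \<equiv> \<lambda>n. if v n then One else Zero"
  shows "(truth v a \<longrightarrow> flw_seq H [] (Some (subst (s v) a))) \<and>
    (\<not> truth v a \<longrightarrow> flw_seq H [subst (s v) a] None)"
proof (induction a)
  case (Var n)
  show ?case by (simp add: s_def flw_seq.OneR flw_seq.ZeroL)
next
  case Zero
  show ?case by (simp add: flw_seq.ZeroL)
next
  case One
  show ?case by (simp add: flw_seq.OneR)
next
  case (Conj a b)
  then show ?case
    using flw_seq.ConjL1[of H "[]" "subst (s v) a" "[]" None "subst (s v) b"]
      flw_seq.ConjL2[of H "[]" "subst (s v) b" "[]" None "subst (s v) a"]
    by (auto intro: flw_seq.ConjR)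
next
  case (Disj a b)
  then show ?case
    using flw_seq.DisjL[of H "[]" "subst (s v) a" "[]" None "subst (s v) b"]
    by (auto intro: flw_seq.DisjR1 flw_seq.DisjR2)
next
  case (Fuse a b)
  then show ?case
    using flw_seq.FuseR[of H "[]" "subst (s v) a" "[]" "subst (s v) b"]
      flw_seq.FuseL[of H "[]" "subst (s v) a" "subst (s v) b" "[]" None]
      flw_seq.WeakL[of H "[subst (s v) a]" "[]" None "subst (s v) b"]
      flw_seq.WeakL[of H "[]" "[subst (s v) b]" None "subst (s v) a"]
    by auto
next
  case (Under a b)
  then show ?case
    using flw_seq.UnderL[of H "[]" "subst (s v) a" "[]" "subst (s v) b" "[]" None]
      flw_seq.UnderR[of H "subst (s v) a" "[]" "subst (s v) b"]
    by (auto intro: flw_seq.WeakR flw_weakL_single)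
next
  case (Over b a)
  then show ?case
    using flw_seq.OverL[of H "[]" "subst (s v) a" "[]" "subst (s v) b" "[]" None]
      flw_seq.OverR[of H "[]" "subst (s v) a" "subst (s v) b"]
    by (auto intro: flw_seq.WeakR flw_weakL_single)
qed

text \<open>A set has no order along which to fold \<open>Conj\<close>, so a conjunction is only
  shown to exist, by adding one element at a time.\<close>

lemma finite_conjunction_exists:
  assumes "finite S"
  shows "\<exists>c. FLw S c \<and> (\<forall>v. truth v c \<longleftrightarrow> (\<forall>a\<in>S. truth v a))"
  using assms
proof (induction S rule: finite_induct)
  case empty
  show ?case by (intro exI[of _ One]) (simp add: FLw_def flw_seq.OneR)
next
  case (insert a S)
  then obtain c where c: "FLw S c" "\<And>v. truth v c \<longleftrightarrow> (\<forall>a\<in>S. truth v a)"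
    by blast
  then have "flw_seq (insert a S) [] (Some c)"
    unfolding FLw_def by (blast intro: flw_mono)
  then have "FLw (insert a S) (Conj a c)"
    by (simp add: FLw_def flw_seq.ConjR flw_seq.Hyp)
  then show ?case using c(2) by (intro exI[of _ "Conj a c"]) simp
qed

text \<open>Two cuts in effect give the empty sequent, and \<open>WeakR\<close> then yields any
  formula.\<close>

lemma flw_contradiction:
  assumes "FLw H a" "FLw H (lneg a)"
  shows "FLw H c"
proof -
  have "flw_seq H ([] @ [] @ [lneg a] @ []) None"
    unfolding lneg_def using assms(1)
    by (intro flw_seq.UnderL) (simp_all add: FLw_def flw_seq.ZeroL)
  then have "flw_seq H ([] @ [] @ []) None"
    using assms(2) by (intro flw_seq.Cut[of H "[]" "lneg a"]) (simp_all add: FLw_def)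
  then show ?thesis by (simp add: FLw_def flw_seq.WeakR)
qed

theorem theorem5p21:
  fixes L :: logic
  assumes "axiomatic_extension (glivenko_logic CL FLw) L"
  shows "passively_structurally_complete L"
  unfolding passively_structurally_complete_def derivable_rule_def
proof (intro allI impI)
  fix S c
  assume fin: "finite S" and psv: "passive_rule L S"
  let ?G = "{lneg (rneg b) | b. thm_of CL b}"
  obtain A where "\<And>H a. L H a \<longleftrightarrow> glivenko_logic CL FLw (H \<union> {subst s b | s b. b \<in> A}) a"
    using assms unfolding axiomatic_extension_def by blast
  \<comment> \<open>\<open>B\<close> is the set of substitution instances of
    \<open>A\<close>.\<close>
  then obtain B where L: "\<And>H a. L H a \<longleftrightarrow> FLw (H \<union> B \<union> ?G) a"
    unfolding glivenko_logic_CL_FLw by blast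
  have unsat: "\<exists>a\<in>S. \<not> truth v a" for v
  proof (rule ccontr)
    assume "\<not> (\<exists>a\<in>S. \<not> truth v a)"
    then have "\<forall>a\<in>S. thm_of L (subst (\<lambda>n. if v n then One else Zero) a)"
      unfolding L FLw_def using flw_two_valued_subst by blast
    then show False using psv unfolding passive_rule_def by blast
  qed
  obtain d where d: "FLw S d" "\<And>v. truth v d \<longleftrightarrow> (\<forall>a\<in>S. truth v a)"
    using finite_conjunction_exists[OF fin] by blast
  have "thm_of CL (lneg d)"
    using d(2) unsat by (auto simp: CL_def lneg_def)
  \<comment> \<open>Glivenko equivalence is applied to the logic axiomatized by \<open>?G\<close>,
    with no premises; monotonicity then adds \<open>S\<close> and \<open>B\<close>.\<close>
  then have "FLw ?G (lneg d)"
    using is_least_glivenko(2) unfolding glivenko_equivalent_def by simp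
  then have "FLw (S \<union> B \<union> ?G) (lneg d)"
    unfolding FLw_def by (rule flw_mono) blast
  moreover have "FLw (S \<union> B \<union> ?G) d"
    using d(1) unfolding FLw_def by (rule flw_mono) blast
  ultimately show "L S c" unfolding L using flw_contradiction by blast
qed

end
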